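(* For every integer $d \geq 1$, $C_d \leq 1 - \frac{7-4\sqrt{3}}{75}$, where \[ C_d = \sup\, \mathbb{P}\left(\left|\sum_{j=1}^n A_j\xi_j\right| > \sqrt{\mathbb{E}\left|\sum_{j=1}^n A_j\xi_j\right|^2}\right), \] the supremum being over all integers $n \geq 1$ and all $d \times d$ real matrices $A_1, \dots, A_n$.
   Context: For a fixed integer $d \geq 1$, $\xi_1, \xi_2, \dots$ are independent random vectors in $\mathbb{R}^d$, each uniformly distributed on the unit sphere $S^{d-1} = \{x \in \mathbb{R}^d : |x| = 1\}$, where $|\cdot|$ is the Euclidean norm (for $d=1$ these are independent random signs taking values $\pm 1$ with probability $\frac12$). *)

theory Defs
  imports "HOL-Probability.Probability"
begin

(* Uniform distribution on the unit sphere as the normalised cone measure: the law of x / |x| for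
   x uniform in the unit ball (sgn x = x /\<^sub>R norm x, and the value sgn 0 = 0 is taken on a null
   set).  It equals the normalised surface measure, and for dimension 1 the law of a fair sign;
   the lemmas below show that it is the rotation-invariant probability measure on the sphere. *)
definition uniform_sphere :: "(real ^ 'd::finite) measure" where
  "uniform_sphere = distr (uniform_measure lborel (ball 0 1)) borel sgn"

lemma prob_space_uniform_sphere: "prob_space (uniform_sphere :: (real ^ 'd::finite) measure)"
proof -
  have "emeasure lborel (ball (0 :: real ^ 'd) 1) \<noteq> 0"
    by (simp add: emeasure_ball unit_ball_vol_pos less_imp_neq[symmetric])
  moreover have "emeasure lborel (ball (0 :: real ^ 'd) 1) \<noteq> \<infinity>"
    using emeasure_lborel_ball_finite[of "0 :: real ^ 'd" 1] by simp
  ultimately have "prob_space (uniform_measure lborel (ball (0 :: real ^ 'd) 1))"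
    by (rule prob_space_uniform_measure)
  then show ?thesis
    unfolding uniform_sphere_def by (rule prob_space.prob_space_distr) simp
qed

lemma AE_uniform_sphere: "AE x in (uniform_sphere :: (real ^ 'd::finite) measure). norm x = 1"
proof -
  have "AE x in lborel. (x :: real ^ 'd) \<noteq> 0"
    by (rule AE_lborel_singleton)
  then have "AE x in uniform_measure lborel (ball 0 1). (x :: real ^ 'd) \<noteq> 0"
    by (auto intro: AE_uniform_measureI)
  then show ?thesis
    unfolding uniform_sphere_def by (auto simp: AE_distr_iff norm_sgn)
qed

lemma nn_integral_lborel_translate:
  fixes g :: "'a::euclidean_space \<Rightarrow> ennreal"
  assumes [measurable]: "g \<in> borel_measurable borel"
  shows "(\<integral>\<^sup>+x. g (c + x) \<partial>lborel) = (\<integral>\<^sup>+x. g x \<partial>lborel)"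
  using nn_integral_distr[of "(+) c" lborel borel g]
  by (simp add: lborel_distr_plus)

lemma nn_integral_lborel_reflect:
  fixes g :: "'a::euclidean_space \<Rightarrow> ennreal"
  assumes [measurable]: "g \<in> borel_measurable borel"
  shows "(\<integral>\<^sup>+x. g (c - x) \<partial>lborel) = (\<integral>\<^sup>+x. g x \<partial>lborel)"
proof -
  have "(\<integral>\<^sup>+x. g x \<partial>lborel) = (\<integral>\<^sup>+x. g x \<partial>distr lborel borel (\<lambda>x. c + (-1) *\<^sub>R x))"
    using lborel_affine[of "-1" c] by (simp add: density_1 one_ennreal_def[symmetric])
  also have "\<dots> = (\<integral>\<^sup>+x. g (c - x) \<partial>lborel)"
    by (subst nn_integral_distr) auto
  finally show ?thesis ..
qed

lemma emeasure_lborel_orthogonal: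
  fixes T :: "'a::euclidean_space \<Rightarrow> 'a"
  assumes T: "orthogonal_transformation T" and A[measurable]: "A \<in> sets borel"
  shows "emeasure lborel (T -` A) = emeasure lborel A"
proof -
  define B where "B = ball (0 :: 'a) 1"
  let ?f = "indicator A :: 'a \<Rightarrow> ennreal" and ?g = "indicator B :: 'a \<Rightarrow> ennreal"
  have [measurable]: "B \<in> sets borel"
    by (simp add: B_def)
  have lin: "linear T" and nrm: "\<And>x. norm (T x) = norm x"
    using T by (auto simp: orthogonal_transformation)
  have [measurable]: "T \<in> borel_measurable borel"
    using lin by (intro borel_measurable_continuous_onI linear_continuous_on)
      (simp add: linear_conv_bounded_linear)
  have TA [measurable]: "T -` A \<in> sets borel"
    using A by (rule measurable_sets_borel[rotated]) simp
  define R where "R = inv T"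
  have TR: "T (R y) = y" for y
    unfolding R_def by (rule surj_f_inv_f[OF orthogonal_transformation_surj[OF T]])
  have add: "T (x + y) = T x + T y" and neg: "T (- x) = - T x" for x y
    using lin by (simp_all add: linear_add linear_neg)
  have fT: "(\<integral>\<^sup>+x. ?f (T x) \<partial>lborel) = emeasure lborel (T -` A)"
    using nn_integral_indicator[of "T -` A" lborel] by (simp add: indicator_def)
  have gT: "?g (T x) = ?g x" for x
    by (simp add: indicator_def nrm B_def)
  have "emeasure lborel (T -` A) * emeasure lborel B
      = (\<integral>\<^sup>+x. ?f (T x) * (\<integral>\<^sup>+y. ?g y \<partial>lborel) \<partial>lborel)"
    by (simp add: nn_integral_multc fT)
  also have "\<dots> = (\<integral>\<^sup>+x. (\<integral>\<^sup>+y. ?f (T x) * ?g (T x + y) \<partial>lborel) \<partial>lborel)"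
  proof (rule nn_integral_cong)
    fix x :: 'a
    have "(\<integral>\<^sup>+y. ?f (T x) * ?g (T x + y) \<partial>lborel) = ?f (T x) * (\<integral>\<^sup>+y. ?g (T x + y) \<partial>lborel)"
      by (rule nn_integral_cmult) measurable
    then show "?f (T x) * (\<integral>\<^sup>+y. ?g y \<partial>lborel) = (\<integral>\<^sup>+y. ?f (T x) * ?g (T x + y) \<partial>lborel)"
      by (subst (asm) nn_integral_lborel_translate) simp_all
  qed
  also have "\<dots> = (\<integral>\<^sup>+y. (\<integral>\<^sup>+x. ?f (T x) * ?g (T x + y) \<partial>lborel) \<partial>lborel)"
    by (rule lborel_pair.Fubini') measurable
  also have "\<dots> = (\<integral>\<^sup>+y. (\<integral>\<^sup>+x. ?f (T x - y) * ?g (T x) \<partial>lborel) \<partial>lborel)"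
  proof (rule nn_integral_cong)
    fix y :: 'a
    have "T (- R y + x) = T x - y" for x
      by (simp only: add neg TR) simp
    then show "(\<integral>\<^sup>+x. ?f (T x) * ?g (T x + y) \<partial>lborel) = (\<integral>\<^sup>+x. ?f (T x - y) * ?g (T x) \<partial>lborel)"
      using nn_integral_lborel_translate[of "\<lambda>x. ?f (T x) * ?g (T x + y)" "- R y"] by simp
  qed
  also have "\<dots> = (\<integral>\<^sup>+x. (\<integral>\<^sup>+y. ?f (T x - y) * ?g (T x) \<partial>lborel) \<partial>lborel)"
    by (rule lborel_pair.Fubini') measurable
  also have "\<dots> = emeasure lborel A * emeasure lborel B"
    by (simp add: nn_integral_multc nn_integral_lborel_reflect[of ?f] gT nn_integral_cmult)
  finally have "emeasure lborel (T -` A) * emeasure lborel B = emeasure lborel A * emeasure lborel B" .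
  moreover have "emeasure lborel B \<noteq> 0"
    by (simp add: B_def emeasure_ball unit_ball_vol_pos less_imp_neq[symmetric])
  moreover have "emeasure lborel B \<noteq> \<infinity>"
    using emeasure_lborel_ball_finite[of "0 :: 'a" 1] by (simp add: B_def)
  ultimately show ?thesis
    by (simp add: mult.commute[of _ "emeasure lborel B"] ennreal_mult_cancel_left)
qed

lemma uniform_sphere_rotation_invariant:
  fixes T :: "real ^ 'd::finite \<Rightarrow> real ^ 'd"
  assumes T: "orthogonal_transformation T"
  shows "distr uniform_sphere borel T = uniform_sphere"
proof -
  let ?B = "ball (0 :: real ^ 'd) 1"
  let ?U = "uniform_measure lborel ?B"
  have lin: "linear T" and nrm: "\<And>x. norm (T x) = norm x"
    using T by (auto simp: orthogonal_transformation)
  have [measurable]: "T \<in> borel_measurable borel"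
    using lin by (intro borel_measurable_continuous_onI linear_continuous_on) (simp add: linear_conv_bounded_linear)
  have sgnT: "T (sgn x) = sgn (T x)" for x
    by (simp add: sgn_div_norm nrm linear_cmul[OF lin])
  have inv: "distr ?U borel T = ?U"
  proof (rule measure_eqI)
    fix A assume "A \<in> sets (distr ?U borel T)"
    then have A: "A \<in> sets borel"
      by simp
    then have TA: "T -` A \<in> sets borel"
      by (rule measurable_sets_borel[rotated]) simp
    have "?B \<inter> T -` A = T -` (?B \<inter> A)"
      by (auto simp: nrm)
    then show "emeasure (distr ?U borel T) A = emeasure ?U A"
      using A TA emeasure_lborel_orthogonal[OF T, of "?B \<inter> A"] by (simp add: emeasure_distr)
  qed simp
  have "distr uniform_sphere borel T = distr ?U borel (\<lambda>x. T (sgn x))"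
    unfolding uniform_sphere_def by (simp add: distr_distr o_def)
  also have "\<dots> = distr (distr ?U borel T) borel sgn"
    by (simp add: distr_distr o_def sgnT)
  finally show ?thesis
    by (simp add: inv uniform_sphere_def)
qed

(* Supremum over all n \<ge> 1 and all d x d matrices A 1, ..., A n (the remaining entries of the
   sequence A are irrelevant).  The set is nonempty and, as M will be a probability space,
   bounded above by 1, so this real Sup is a true supremum. *)
definition tail_sup :: "'a measure \<Rightarrow> (nat \<Rightarrow> 'a \<Rightarrow> real ^ 'd::finite) \<Rightarrow> real" where
  "tail_sup M \<xi> = Sup {measure M {\<omega> \<in> space M. norm (\<Sum>j=1..n. A j *v \<xi> j \<omega>)
        > sqrt (\<integral>\<omega>. (norm (\<Sum>j=1..n. A j *v \<xi> j \<omega>))\<^sup>2 \<partial>M)}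
      | (n :: nat) (A :: nat \<Rightarrow> real ^ 'd ^ 'd). n \<ge> 1}"

end

theory Submission
  imports Defs
begin

text \<open>
  Each matrix \<open>A j\<close> has an orthonormal basis \<open>e j\<close> on which \<open>\<bar>A j e\<bar>\<close> is constant.
  Flipping the signs of the coordinates of \<open>\<xi> j\<close> in that basis is orthogonal, so it does not change
  the joint law, and it turns the sum into a Rademacher sum \<open>\<Sum>k. \<epsilon> k v k\<close> with vectors \<open>v k\<close> depending
  on \<open>\<xi>\<close> such that \<open>\<Sum>k. \<bar>v k\<bar>\<^sup>2\<close> is almost surely the second moment of the sum.
  Conditionally on \<open>\<xi>\<close> it remains to see that the centred Rademacher chaos
  \<open>Y = \<bar>\<Sum>k. \<epsilon> k v k\<bar>\<^sup>2 - (\<Sum>k. \<bar>v k\<bar>\<^sup>2)\<close> satisfies \<open>Y \<le> 0\<close> with probability at least \<open>1 / 114\<close>;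
  this follows from \<open>E Y\<^sup>4 \<le> 27 (E Y\<^sup>2)\<^sup>2\<close> and a quartic minorant of the indicator of \<open>{..0}\<close>.
  The bound obtained, \<open>113 / 114\<close>, is stronger than the required one.
\<close>

subsection \<open>Rademacher sums and chaos of degree two\<close>

definition sgn_of :: "'k set \<Rightarrow> 'k \<Rightarrow> real" where
  "sgn_of B k = (if k \<in> B then 1 else - 1)"

text \<open>Sign vectors on \<open>K\<close> are encoded as subsets of \<open>K\<close>.\<close>

definition sign_avg :: "'k set \<Rightarrow> ('k set \<Rightarrow> real) \<Rightarrow> real" where
  "sign_avg K f = (\<Sum>B\<in>Pow K. f B) / 2 ^ card K"

lemma sgn_of_sq [simp]: "sgn_of B k * sgn_of B k = 1"
  by (simp add: sgn_of_def)

lemma sign_avg_add: "sign_avg K (\<lambda>B. f B + g B) = sign_avg K f + sign_avg K g"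
  by (simp add: sign_avg_def sum.distrib add_divide_distrib)

lemma sign_avg_cmult: "sign_avg K (\<lambda>B. c * f B) = c * sign_avg K f"
  by (simp add: sign_avg_def sum_distrib_left)

lemma sign_avg_const: "finite K \<Longrightarrow> sign_avg K (\<lambda>B. c) = c"
  by (simp add: sign_avg_def card_Pow)

lemma sign_avg_mono: "(\<And>B. f B \<le> g B) \<Longrightarrow> sign_avg K f \<le> sign_avg K g"
  unfolding sign_avg_def by (intro divide_right_mono sum_mono) auto

lemma sign_avg_Cauchy_Schwarz:
  "(sign_avg K (\<lambda>B. f B * g B))\<^sup>2 \<le> sign_avg K (\<lambda>B. (f B)\<^sup>2) * sign_avg K (\<lambda>B. (g B)\<^sup>2)"
proof -
  have "(sign_avg K (\<lambda>B. f B * g B))\<^sup>2 = (\<Sum>B\<in>Pow K. f B * g B)\<^sup>2 / (2 ^ card K)\<^sup>2"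
    by (simp add: sign_avg_def power_divide)
  also have "\<dots> \<le> ((\<Sum>B\<in>Pow K. (f B)\<^sup>2) * (\<Sum>B\<in>Pow K. (g B)\<^sup>2)) / (2 ^ card K)\<^sup>2"
    by (intro divide_right_mono Cauchy_Schwarz_ineq_sum) simp
  finally show ?thesis by (simp add: sign_avg_def power2_eq_square)
qed

lemma sign_avg_cong_Pow: "(\<And>B. B \<subseteq> K \<Longrightarrow> f B = g B) \<Longrightarrow> sign_avg K f = sign_avg K g"
  unfolding sign_avg_def by (intro arg_cong2[where f="(/)"] sum.cong) auto

text \<open>Every subset of \<open>insert x K\<close> is uniquely \<open>B\<close> or
  \<open>insert x B\<close> with \<open>B\<close> inside \<open>K\<close>, so one averages first
  over the sign of \<open>x\<close> and then over the others. All moment inductions below run on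
  this identity.\<close>

lemma sign_avg_insert:
  assumes "finite K" "x \<notin> K"
  shows "sign_avg (insert x K) f = sign_avg K (\<lambda>B. (f B + f (insert x B)) / 2)"
proof -
  have "inj_on (insert x) (Pow K)"
    using assms by (auto simp: inj_on_def)
  moreover have "Pow K \<inter> insert x ` Pow K = {}"
    using assms by auto
  ultimately have "(\<Sum>B\<in>Pow (insert x K). f B) = (\<Sum>B\<in>Pow K. f B + f (insert x B))"
    using assms by (simp add: Pow_insert sum.union_disjoint sum.reindex sum.distrib)
  then show ?thesis
    using assms by (simp add: sign_avg_def sum_divide_distrib[symmetric])
qed

definition sign_sum :: "'k set \<Rightarrow> ('k \<Rightarrow> 'v::real_vector) \<Rightarrow> 'k set \<Rightarrow> 'v" where
  "sign_sum K v B = (\<Sum>k\<in>K. sgn_of B k *\<^sub>R v k)"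

lemma sign_sum_insert:
  assumes "finite K" "x \<notin> K" "B \<subseteq> K"
  shows "sign_sum (insert x K) v B = sign_sum K v B - v x"
    and "sign_sum (insert x K) v (insert x B) = sign_sum K v B + v x"
proof -
  have "(\<Sum>k\<in>K. sgn_of (insert x B) k *\<^sub>R v k) = (\<Sum>k\<in>K. sgn_of B k *\<^sub>R v k)"
    using assms by (intro sum.cong) (auto simp: sgn_of_def)
  moreover have "x \<notin> B" using assms by auto
  ultimately show "sign_sum (insert x K) v B = sign_sum K v B - v x"
    "sign_sum (insert x K) v (insert x B) = sign_sum K v B + v x"
    using assms by (auto simp: sign_sum_def) (simp_all add: sgn_of_def)
qed

lemma sign_avg_sign_sum_insert:
  assumes "finite K" "x \<notin> K"
  shows "sign_avg (insert x K) (\<lambda>B. g (sign_sum (insert x K) v B)) =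
    sign_avg K (\<lambda>B. (g (sign_sum K v B - v x) + g (sign_sum K v B + v x)) / 2)"
  unfolding sign_avg_insert[OF assms]
  by (rule sign_avg_cong_Pow) (simp add: sign_sum_insert[OF assms])

text \<open>Khinchin's inequality with the Gaussian constant 3. A new coefficient \<open>a\<close>
  turns the second moment \<open>m\<close> into \<open>m + a^2\<close> and the fourth moment
  \<open>q\<close> into \<open>q + 6 a^2 m + a^4\<close>; the right-hand side grows by
  \<open>2 a^4\<close> more than needed.\<close>

lemma sign_sum_fourth_moment:
  assumes "finite K"
  shows "sign_avg K (\<lambda>B. (sign_sum K v B \<bullet> w) ^ 4) \<le> 3 * (sign_avg K (\<lambda>B. (sign_sum K v B \<bullet> w)\<^sup>2))\<^sup>2"
  using assms
proof (induction K)
  case empty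
  then show ?case by (simp add: sign_avg_def sign_sum_def)
next
  case (insert x K)
  let ?l = "\<lambda>B. sign_sum K v B \<bullet> w" and ?a = "v x \<bullet> w"
  define m q where "m = sign_avg K (\<lambda>B. (?l B)\<^sup>2)" and "q = sign_avg K (\<lambda>B. (?l B) ^ 4)"
  have "((l - c)\<^sup>2 + (l + c)\<^sup>2) / 2 = l\<^sup>2 + c\<^sup>2" for l c :: real
    by (simp add: power2_eq_square algebra_simps)
  then have 2: "sign_avg (insert x K) (\<lambda>B. (sign_sum (insert x K) v B \<bullet> w)\<^sup>2) = m + ?a\<^sup>2"
    using sign_avg_sign_sum_insert[OF insert(1,2), of "\<lambda>s. (s \<bullet> w)\<^sup>2" v]
    by (simp only: inner_add_left inner_diff_left sign_avg_add sign_avg_const insert(1) m_def)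
  have "((l - c) ^ 4 + (l + c) ^ 4) / 2 = l ^ 4 + 6 * c\<^sup>2 * l\<^sup>2 + c ^ 4" for l c :: real
    by (simp add: power2_eq_square power4_eq_xxxx algebra_simps)
  then have 4: "sign_avg (insert x K) (\<lambda>B. (sign_sum (insert x K) v B \<bullet> w) ^ 4) = q + 6 * ?a\<^sup>2 * m + ?a ^ 4"
    using sign_avg_sign_sum_insert[OF insert(1,2), of "\<lambda>s. (s \<bullet> w) ^ 4" v]
    by (simp only: inner_add_left inner_diff_left sign_avg_add sign_avg_cmult sign_avg_const insert(1) m_def q_def)
  have "q \<le> 3 * m\<^sup>2" using insert.IH by (simp add: m_def q_def)
  moreover have "3 * (m + ?a\<^sup>2)\<^sup>2 = 3 * m\<^sup>2 + 6 * ?a\<^sup>2 * m + ?a ^ 4 + 2 * ?a ^ 4"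
    by (simp add: power2_eq_square power4_eq_xxxx algebra_simps)
  moreover have "0 \<le> ?a ^ 4" by simp
  ultimately show ?case unfolding 2 4 by linarith
qed

section \<open>Moments and nonpositivity of the degree-two chaos\<close>

definition sign_chaos :: "'k set \<Rightarrow> ('k \<Rightarrow> 'v::real_inner) \<Rightarrow> 'k set \<Rightarrow> real" where
  "sign_chaos K v B = (norm (sign_sum K v B))\<^sup>2 - (\<Sum>k\<in>K. (norm (v k))\<^sup>2)"

text \<open>Subtracting the diagonal leaves only the cross terms of the squared norm. A new sign
  therefore adds or subtracts twice the inner product of \<open>v x\<close> with the old sum: the
  increment is a linear Rademacher sum, covered by \<open>sign_sum_fourth_moment\<close>.\<close>

lemma sign_avg_chaos_insert:
  assumes "finite K" "x \<notin> K"
  shows "sign_avg (insert x K) (\<lambda>B. g (sign_chaos (insert x K) v B)) =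
    sign_avg K (\<lambda>B. (g (sign_chaos K v B - sign_sum K v B \<bullet> (2 *\<^sub>R v x)) +
                     g (sign_chaos K v B + sign_sum K v B \<bullet> (2 *\<^sub>R v x))) / 2)"
proof -
  let ?N = "\<Sum>k\<in>K. (norm (v k))\<^sup>2"
  have "(norm (s - v x))\<^sup>2 - ((norm (v x))\<^sup>2 + ?N) = (norm s)\<^sup>2 - ?N - s \<bullet> (2 *\<^sub>R v x)"
    and "(norm (s + v x))\<^sup>2 - ((norm (v x))\<^sup>2 + ?N) = (norm s)\<^sup>2 - ?N + s \<bullet> (2 *\<^sub>R v x)" for s
    by (simp_all add: power2_norm_eq_inner inner_add_left inner_add_right inner_diff_left inner_diff_right
        inner_commute[of "v x" s])
  moreover have "(\<Sum>k\<in>insert x K. (norm (v k))\<^sup>2) = (norm (v x))\<^sup>2 + ?N"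
    using assms by simp
  ultimately show ?thesis
    using sign_avg_sign_sum_insert[OF assms, of "\<lambda>s. g ((norm s)\<^sup>2 - (\<Sum>k\<in>insert x K. (norm (v k))\<^sup>2))" v]
    by (simp only: sign_chaos_def)
qed

lemma sign_chaos_mean:
  assumes "finite K"
  shows "sign_avg K (sign_chaos K v) = 0"
  using assms
proof (induction K)
  case empty
  then show ?case by (simp add: sign_avg_def sign_chaos_def sign_sum_def)
next
  case (insert x K)
  have "((y - l) + (y + l)) / 2 = y" for y l :: real
    by simp
  then have "sign_avg (insert x K) (\<lambda>B. sign_chaos (insert x K) v B) = sign_avg K (\<lambda>B. sign_chaos K v B)"
    using sign_avg_chaos_insert[OF insert(1,2), of "\<lambda>y. y" v] by (simp only:)
  then show ?case using insert.IH by (simp only:)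
qed

text \<open>The fourth moment of \<open>y\<close> plus or minus \<open>l\<close> has the mixed term
  \<open>6 e\<close>, and Cauchy-Schwarz bounds \<open>e\<close> by the two fourth moments. With
  constant 3 for \<open>l\<close> and C for \<open>y\<close>, the induction closes when
  \<open>6 sqrt(3 C) <= 2 C\<close>, that is for \<open>C >= 27\<close>.\<close>

lemma sign_chaos_fourth_moment:
  assumes "finite K"
  shows "sign_avg K (\<lambda>B. sign_chaos K v B ^ 4) \<le> 27 * (sign_avg K (\<lambda>B. (sign_chaos K v B)\<^sup>2))\<^sup>2"
  using assms
proof (induction K)
  case empty
  then show ?case by (simp add: sign_avg_def sign_chaos_def sign_sum_def)
next
  case (insert x K)
  let ?y = "sign_chaos K v" and ?l = "\<lambda>B. sign_sum K v B \<bullet> (2 *\<^sub>R v x)"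
  define a b c d e where "a = sign_avg K (\<lambda>B. (?y B)\<^sup>2)" and "b = sign_avg K (\<lambda>B. (?l B)\<^sup>2)"
    and "c = sign_avg K (\<lambda>B. ?y B ^ 4)" and "d = sign_avg K (\<lambda>B. ?l B ^ 4)"
    and "e = sign_avg K (\<lambda>B. (?y B)\<^sup>2 * (?l B)\<^sup>2)"
  have "((y - l)\<^sup>2 + (y + l)\<^sup>2) / 2 = y\<^sup>2 + l\<^sup>2" for y l :: real
    by (simp add: power2_eq_square algebra_simps)
  then have 2: "sign_avg (insert x K) (\<lambda>B. (sign_chaos (insert x K) v B)\<^sup>2) = a + b"
    using sign_avg_chaos_insert[OF insert(1,2), of "\<lambda>y. y\<^sup>2" v]
    by (simp only: sign_avg_add a_def b_def)
  have "((y - l) ^ 4 + (y + l) ^ 4) / 2 = y ^ 4 + 6 * (y\<^sup>2 * l\<^sup>2) + l ^ 4" for y l :: real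
    by (simp add: power2_eq_square power4_eq_xxxx algebra_simps)
  then have 4: "sign_avg (insert x K) (\<lambda>B. sign_chaos (insert x K) v B ^ 4) = c + 6 * e + d"
    using sign_avg_chaos_insert[OF insert(1,2), of "\<lambda>y. y ^ 4" v]
    by (simp only: sign_avg_add sign_avg_cmult c_def d_def e_def)
  have c: "c \<le> 27 * a\<^sup>2" using insert.IH by (simp add: a_def c_def)
  have d: "d \<le> 3 * b\<^sup>2" unfolding b_def d_def by (rule sign_sum_fourth_moment[OF insert(1)])
  have nn: "0 \<le> a" "0 \<le> b" "0 \<le> d"
    unfolding a_def b_def d_def sign_avg_def by (auto intro!: divide_nonneg_nonneg sum_nonneg)
  have "e\<^sup>2 \<le> c * d"
    using sign_avg_Cauchy_Schwarz[of K "\<lambda>B. (?y B)\<^sup>2" "\<lambda>B. (?l B)\<^sup>2"]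
    by (simp add: c_def d_def e_def power_mult[symmetric])
  also have "\<dots> \<le> (27 * a\<^sup>2) * (3 * b\<^sup>2)"
    using c d nn by (intro mult_mono) auto
  also have "\<dots> = (9 * (a * b))\<^sup>2" by (simp add: power_mult_distrib)
  finally have "e \<le> 9 * (a * b)" by (rule power2_le_imp_le) (use nn in simp)
  moreover have "27 * (a + b)\<^sup>2 = 27 * a\<^sup>2 + 54 * (a * b) + 3 * b\<^sup>2 + 24 * b\<^sup>2"
    by (simp add: power2_eq_square algebra_simps)
  ultimately show ?case unfolding 2 4 using c d zero_le_power2[of b] by linarith
qed

text \<open>The coefficient \<open>54 = 2 \<cdot> 27\<close> is matched to the moment bound: for \<open>E z = 0\<close>, \<open>E z\<^sup>2 = 1\<close>,
  \<open>E z\<^sup>4 \<le> 27\<close> the left-hand side has mean at least 27.\<close>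

lemma quartic_le_indicator:
  fixes z :: real
  shows "54 * z\<^sup>2 - z ^ 4 - 162 * z \<le> 3078 * of_bool (z \<le> 0)"
proof (cases "z \<le> 0")
  case True
  \<comment> \<open>Completing squares gives the constant
    \<open>54^2 + 54 * (9/4) + 81/2 = 3078 = 54 * 57\<close>.\<close>
  have "0 \<le> (z\<^sup>2 - 54)\<^sup>2 + 54 * (z + 3/2)\<^sup>2 + 81/2"
    by (intro add_nonneg_nonneg) auto
  also have "\<dots> = 54 * (57 - (z\<^sup>2 - 3 * z)) + z ^ 4"
    by (simp add: power2_eq_square power4_eq_xxxx algebra_simps)
  finally show ?thesis using True by simp
next
  case False
  \<comment> \<open>After dividing by \<open>z\<close>, the cubic \<open>z^3 - 54 z + 162\<close>
    has to be nonnegative. On the positive axis its minimum is at \<open>sqrt 18\<close>,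
    approximated here by the double root \<open>17/4\<close>.\<close>
  then have "0 \<le> z * (((4 * z - 17)\<^sup>2 * (2 * z + 17)) + 6 * z + 271)"
    by (intro mult_nonneg_nonneg add_nonneg_nonneg) simp_all
  also have "\<dots> = 32 * (162 * z - 54 * z\<^sup>2 + z ^ 4)"
    by algebra
  finally show ?thesis using False by simp
qed

text \<open>Rescale to unit variance and average the quartic bound: the linear term has mean zero,
  so \<open>54 - 27 <= 3078 p\<close>, whence \<open>p >= 1/114\<close>. With zero variance the
  chaos vanishes for every choice of signs.\<close>

lemma sign_chaos_nonpos:
  assumes "finite K"
  shows "1 / 114 \<le> sign_avg K (\<lambda>B. of_bool (sign_chaos K v B \<le> 0))"
proof -
  let ?y = "sign_chaos K v"
  define s where "s = sign_avg K (\<lambda>B. (?y B)\<^sup>2)"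
  have "0 \<le> s" unfolding s_def sign_avg_def by (auto intro!: divide_nonneg_nonneg sum_nonneg)
  show ?thesis
  proof (cases "s = 0")
    case True
    then have "\<And>B. B \<subseteq> K \<Longrightarrow> ?y B = 0"
      using assms by (simp add: s_def sign_avg_def sum_nonneg_eq_0_iff)
    then have "sign_avg K (\<lambda>B. of_bool (?y B \<le> 0)) = sign_avg K (\<lambda>B. 1)"
      by (intro sign_avg_cong_Pow) auto
    then show ?thesis using assms by (simp add: sign_avg_const)
  next
    case False
    with \<open>0 \<le> s\<close> have s: "s > 0" by simp
    define r where "r = sqrt s"
    have r: "r > 0" "r\<^sup>2 = s" "r ^ 4 = s\<^sup>2"
      using s by (simp_all add: r_def power4_eq_xxxx power2_eq_square)
    have "(54 / s) * (?y B)\<^sup>2 + (- 1 / s\<^sup>2) * ?y B ^ 4 + (- 162 / r) * ?y B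
      \<le> 3078 * of_bool (?y B \<le> 0)" for B
      using quartic_le_indicator[of "?y B / r"] r by (simp add: power_divide divide_le_0_iff)
    then have "sign_avg K (\<lambda>B. (54 / s) * (?y B)\<^sup>2 + (- 1 / s\<^sup>2) * ?y B ^ 4 + (- 162 / r) * ?y B)
      \<le> sign_avg K (\<lambda>B. 3078 * of_bool (?y B \<le> 0))"
      by (rule sign_avg_mono)
    then have "(54 / s) * s + (- 1 / s\<^sup>2) * sign_avg K (\<lambda>B. ?y B ^ 4)
      \<le> 3078 * sign_avg K (\<lambda>B. of_bool (?y B \<le> 0))"
      by (simp only: sign_avg_add sign_avg_cmult sign_chaos_mean[OF assms] s_def[symmetric] mult_zero_right add_0_right)
    moreover have "(- 1 / s\<^sup>2) * (27 * s\<^sup>2) \<le> (- 1 / s\<^sup>2) * sign_avg K (\<lambda>B. ?y B ^ 4)"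
      unfolding s_def by (intro mult_left_mono_neg sign_chaos_fourth_moment assms) simp
    moreover have "(54 / s) * s = 54" "(- 1 / s\<^sup>2) * (27 * s\<^sup>2) = - 27"
      using s by simp_all
    ultimately show ?thesis by linarith
  qed
qed

subsection \<open>Sign flips in an orthonormal basis\<close>

text \<open>Indexing by the dimension type itself makes such a family a basis.\<close>

definition orthonormal_family :: "('d::finite \<Rightarrow> real ^ 'd) \<Rightarrow> bool" where
  "orthonormal_family e \<longleftrightarrow> (\<forall>a b. e a \<bullet> e b = of_bool (a = b))"

text \<open>The matrix with rows \<open>e a\<close> is orthogonal, hence preserves inner products,
  and its action lists the coordinates \<open>x \<bullet> e a\<close>.\<close>

lemma orthonormal_family_Parseval:
  assumes "orthonormal_family (e :: 'd::finite \<Rightarrow> real ^ 'd)"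
  shows "x \<bullet> y = (\<Sum>a\<in>UNIV. (x \<bullet> e a) * (y \<bullet> e a))"
proof -
  define Q :: "real ^ 'd ^ 'd" where "Q = (\<chi> a. e a)"
  have "row a Q = e a" for a by (simp add: row_def Q_def)
  then have "orthogonal_matrix Q"
    using assms by (auto simp: orthogonal_matrix_orthonormal_rows orthonormal_family_def norm_eq_1 orthogonal_def)
  then have "(Q *v x) \<bullet> (Q *v y) = x \<bullet> y"
    using orthogonal_transformation_matrix[of "(*v) Q"] by (simp add: orthogonal_transformation_def)
  moreover have "(Q *v z) $ a = z \<bullet> e a" for z a
    by (simp add: matrix_vector_mult_def Q_def inner_vec_def mult.commute)
  ultimately show ?thesis by (simp add: inner_vec_def)
qed

definition flip :: "('d::finite \<Rightarrow> real ^ 'd) \<Rightarrow> ('d \<Rightarrow> real) \<Rightarrow> real ^ 'd \<Rightarrow> real ^ 'd" where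
  "flip e s x = (\<Sum>a\<in>UNIV. (s a * (x \<bullet> e a)) *\<^sub>R e a)"

lemma orthogonal_transformation_flip:
  assumes e: "orthonormal_family e" and s: "\<And>a. s a * s a = 1"
  shows "orthogonal_transformation (flip e s)"
  unfolding orthogonal_transformation_def
proof (intro conjI allI)
  show "linear (flip e s)"
    by (intro linearI) (simp_all add: flip_def algebra_simps inner_add_left scaleR_sum_right sum.distrib)
  fix x y
  have "flip e s z \<bullet> e a = s a * (z \<bullet> e a)" for z a
    using e by (simp add: flip_def inner_sum_left orthonormal_family_def of_bool_def if_distrib[of "(*) _"] cong: if_cong split del: if_split)
  then have "flip e s x \<bullet> flip e s y = (\<Sum>a\<in>UNIV. (s a * (x \<bullet> e a)) * (s a * (y \<bullet> e a)))"
    by (subst orthonormal_family_Parseval[OF e]) simp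
  also have "\<dots> = (\<Sum>a\<in>UNIV. (s a * s a) * ((x \<bullet> e a) * (y \<bullet> e a)))"
    by (intro sum.cong) auto
  also have "\<dots> = x \<bullet> y"
    by (simp add: s orthonormal_family_Parseval[OF e, of x y])
  finally show "flip e s x \<bullet> flip e s y = x \<bullet> y" .
qed

section \<open>Plane rotations and bases with images of equal length\<close>

definition plane_rot :: "'d \<Rightarrow> 'd \<Rightarrow> real \<Rightarrow> ('d \<Rightarrow> 'v::real_vector) \<Rightarrow> 'd \<Rightarrow> 'v" where
  "plane_rot a b t e = e(a := cos t *\<^sub>R e a + sin t *\<^sub>R e b, b := cos t *\<^sub>R e b - sin t *\<^sub>R e a)"

lemma orthonormal_family_plane_rot:
  assumes e: "orthonormal_family e" and "a \<noteq> b"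
  shows "orthonormal_family (plane_rot a b t e)"
proof -
  have [simp]: "e c \<bullet> e d = of_bool (c = d)" for c d
    using e by (simp add: orthonormal_family_def)
  have "cos t * cos t + sin t * sin t = 1"
    using sin_cos_squared_add[of t] by (simp add: power2_eq_square)
  then show ?thesis
    using \<open>a \<noteq> b\<close> unfolding orthonormal_family_def plane_rot_def
    by (auto simp: inner_add_left inner_add_right inner_diff_left inner_diff_right)
qed

text \<open>The cross terms of the two rotated vectors cancel and the other vectors do not move. For
  an orthonormal \<open>e\<close> the invariant is the squared Frobenius norm of
  \<open>A\<close>.\<close>

lemma plane_rot_quadratic_sum:
  fixes A :: "real ^ 'd ^ 'd" and e :: "'d::finite \<Rightarrow> real ^ 'd"
  assumes "a \<noteq> b"
  shows "(\<Sum>c\<in>UNIV. (norm (A *v plane_rot a b t e c))\<^sup>2) = (\<Sum>c\<in>UNIV. (norm (A *v e c))\<^sup>2)"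
proof -
  let ?q = "\<lambda>x. (norm (A *v x))\<^sup>2" and ?r = "plane_rot a b t e"
  have split: "(\<Sum>c\<in>UNIV. f c) = f a + f b + (\<Sum>c\<in>UNIV - {a, b}. f c)" for f :: "'d \<Rightarrow> real"
  proof -
    have "(\<Sum>c\<in>UNIV. f c) = (\<Sum>c\<in>{a, b}. f c) + (\<Sum>c\<in>UNIV - {a, b}. f c)"
      by (subst add.commute) (rule sum.subset_diff, auto)
    then show ?thesis using assms by simp
  qed
  define x y where "x = A *v e a" and "y = A *v e b"
  have "?q (?r a) + ?q (?r b)
    = (norm (cos t *\<^sub>R x + sin t *\<^sub>R y))\<^sup>2 + (norm (cos t *\<^sub>R y - sin t *\<^sub>R x))\<^sup>2"
    using assms by (simp add: plane_rot_def x_def y_def matrix_vector_right_distrib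
        matrix_vector_mult_diff_distrib matrix_vector_mult_scaleR)
  also have "\<dots> = (cos t * cos t + sin t * sin t) * ((norm x)\<^sup>2 + (norm y)\<^sup>2)"
    unfolding power2_norm_eq_inner
    by (simp add: inner_add_left inner_add_right inner_diff_left inner_diff_right inner_commute[of y x] algebra_simps del: sin_cos_squared_add3)
  also have "\<dots> = (norm x)\<^sup>2 + (norm y)\<^sup>2" by simp
  finally have "?q (?r a) + ?q (?r b) = ?q (e a) + ?q (e b)" by (simp add: x_def y_def)
  moreover have "(\<Sum>c\<in>UNIV - {a, b}. ?q (?r c)) = (\<Sum>c\<in>UNIV - {a, b}. ?q (e c))"
    by (intro sum.cong) (auto simp: plane_rot_def)
  ultimately show ?thesis by (simp only: split)
qed

text \<open>As the angle runs from 0 to \<open>pi / 2\<close>, the vector at \<open>a\<close> moves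
  continuously from \<open>e a\<close> to \<open>e b\<close>.\<close>

lemma plane_rot_IVT:
  fixes A :: "real ^ 'd ^ 'd" and e :: "'d::finite \<Rightarrow> real ^ 'd"
  assumes "a \<noteq> b" "(norm (A *v e a))\<^sup>2 \<le> m" "m \<le> (norm (A *v e b))\<^sup>2"
  shows "\<exists>t. (norm (A *v plane_rot a b t e a))\<^sup>2 = m"
proof -
  let ?f = "\<lambda>t. (norm (cos t *\<^sub>R (A *v e a) + sin t *\<^sub>R (A *v e b)))\<^sup>2"
  have "\<exists>t\<ge>0. t \<le> pi / 2 \<and> ?f t = m"
    by (rule IVT') (use assms in \<open>auto intro!: continuous_intros\<close>)
  then show ?thesis
    using \<open>a \<noteq> b\<close> by (auto simp: plane_rot_def matrix_vector_right_distrib matrix_vector_mult_scaleR)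
qed

text \<open>Minimise the number of basis vectors with the wrong norm: a plane rotation mixing a vector that
  is too short with one that is too long repairs one of the two and keeps the total.\<close>

lemma equal_norm_orthonormal_family:
  fixes A :: "real ^ 'd ^ 'd::finite"
  obtains e m where "orthonormal_family e" "\<And>a. (norm (A *v e a))\<^sup>2 = m"
proof -
  let ?q = "\<lambda>x. (norm (A *v x))\<^sup>2"
  \<comment> \<open>The common value has to be the mean \<open>m\<close> of the squared norms, since
    rotations preserve their sum \<open>tot\<close>.\<close>
  define tot where "tot = (\<Sum>a\<in>UNIV. ?q (axis a (1::real)))"
  define m where "m = tot / CARD('d)"
  define good where "good e \<longleftrightarrow> orthonormal_family e \<and> (\<Sum>a\<in>UNIV. ?q (e a)) = tot" for e :: "'d \<Rightarrow> real ^ 'd"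
  define bad where "bad e = {a. ?q (e a) \<noteq> m}" for e :: "'d \<Rightarrow> real ^ 'd"
  have "good (\<lambda>a. axis a 1)"
    by (auto simp: good_def tot_def orthonormal_family_def inner_axis_axis)
  then obtain e where e: "good e" and min: "\<And>e'. good e' \<Longrightarrow> card (bad e) \<le> card (bad e')"
    using ex_has_least_nat[of good _ "\<lambda>e. card (bad e)"] by blast
  have sum0: "(\<Sum>a\<in>UNIV. ?q (e a) - m) = 0"
    using e by (simp add: good_def sum_subtractf m_def)
  have "bad e = {}"
  proof (rule ccontr)
    assume "bad e \<noteq> {}"
    then obtain c where c: "?q (e c) - m \<noteq> 0" by (auto simp: bad_def)
    \<comment> \<open>The deviations from \<open>m\<close> sum to zero and are not all zero, so both
      signs occur; \<open>s = 1\<close> gives a vector that is too short, \<open>s = - 1\<close> one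
      that is too long.\<close>
    have neg: "\<exists>a. s * (?q (e a) - m) < 0" if "s \<noteq> 0" for s
    proof (rule ccontr)
      assume "\<not> ?thesis"
      then have nn: "0 \<le> s * (?q (e a) - m)" for a by (metis not_le)
      have "(\<Sum>a\<in>UNIV. s * (?q (e a) - m)) = 0"
        by (simp only: sum_distrib_left[symmetric] sum0 mult_zero_right)
      then have "s * (?q (e c) - m) = 0"
        by (rule sum_nonneg_0[OF finite nn _ UNIV_I])
      then show False using c that by simp
    qed
    obtain a where "1 * (?q (e a) - m) < 0" using neg[of 1] by auto
    then have a: "?q (e a) < m" by simp
    obtain b where "(- 1) * (?q (e b) - m) < 0" using neg[of "- 1"] by auto
    then have b: "m < ?q (e b)" by simp
    have "a \<noteq> b" using a b by auto
    then obtain t where t: "?q (plane_rot a b t e a) = m"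
      using plane_rot_IVT[of a b A e m] a b by (metis less_imp_le)
    let ?r = "plane_rot a b t e"
    have "good ?r"
      using e \<open>a \<noteq> b\<close> by (simp add: good_def orthonormal_family_plane_rot plane_rot_quadratic_sum)
    \<comment> \<open>Both \<open>a\<close> and \<open>b\<close> were bad before the rotation, so
      whatever happens at \<open>b\<close> creates no new bad index.\<close>
    have "c \<in> bad e" if "c \<in> bad ?r" for c
    proof (cases "c = a \<or> c = b")
      case True
      then show ?thesis using a b by (auto simp: bad_def)
    next
      case False
      then have "?r c = e c" by (simp add: plane_rot_def)
      then show ?thesis using that by (simp add: bad_def)
    qed
    moreover have "a \<in> bad e" "a \<notin> bad ?r"
      using a t by (simp_all add: bad_def)
    ultimately have "bad ?r \<subset> bad e" by blast
    then have "card (bad ?r) < card (bad e)" by (intro psubset_card_mono) auto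
    then show False using min[OF \<open>good ?r\<close>] by simp
  qed
  then show ?thesis using e that[of e m] by (auto simp: bad_def good_def)
qed

subsection \<open>Randomisation of the signs\<close>

text \<open>By independence the joint law is the product of the marginals, and each marginal is
  rotation invariant. So applying a separate orthogonal map to each \<xi> j preserves the joint
  law.\<close>

lemma integral_rotated_sum:
  fixes M :: "'a measure" and \<xi> :: "nat \<Rightarrow> 'a \<Rightarrow> real ^ 'd::finite" and h :: "real ^ 'd \<Rightarrow> real"
  assumes M: "prob_space M"
    and indep: "prob_space.indep_vars M (\<lambda>_. borel) \<xi> {1..}"
    and law: "\<And>j. j \<ge> 1 \<Longrightarrow> distr M borel (\<xi> j) = uniform_sphere"
    and R: "\<And>j. orthogonal_transformation (R j)"
    and n: "n \<ge> 1" and [measurable]: "h \<in> borel_measurable borel"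
  shows "(\<integral>\<omega>. h (\<Sum>j=1..n. A j *v R j (\<xi> j \<omega>)) \<partial>M) = (\<integral>\<omega>. h (\<Sum>j=1..n. A j *v \<xi> j \<omega>) \<partial>M)"
proof -
  interpret prob_space M by fact
  let ?P = "PiM {1..n} (\<lambda>_. borel :: (real ^ 'd) measure)"
  have [measurable]: "R j \<in> borel_measurable borel" for j
    using R[of j] by (intro borel_measurable_continuous_onI linear_continuous_on)
      (simp add: orthogonal_transformation_def linear_conv_bounded_linear)
  have [measurable]: "(*v) B \<in> borel_measurable borel" for B :: "real ^ 'd ^ 'd"
    by (intro borel_measurable_continuous_onI linear_continuous_on) (simp add: matrix_vector_mul_bounded_linear)
  have rv: "\<xi> j \<in> borel_measurable M" if "j \<in> {1..n}" for j
    using indep that by (auto simp: indep_vars_def)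
  have ind: "indep_vars (\<lambda>_. borel) \<xi> {1..n}"
    by (rule indep_vars_subset[OF indep]) auto
  have indR: "indep_vars (\<lambda>_. borel) (\<lambda>j \<omega>. R j (\<xi> j \<omega>)) {1..n}"
    by (rule indep_vars_compose2[OF ind]) simp
  have rvR: "(\<lambda>\<omega>. R j (\<xi> j \<omega>)) \<in> borel_measurable M" if "j \<in> {1..n}" for j
    using rv[OF that] by measurable
  have "distr M borel (\<lambda>\<omega>. R j (\<xi> j \<omega>)) = distr M borel (\<xi> j)" if "j \<in> {1..n}" for j
  proof -
    have "distr M borel (\<lambda>\<omega>. R j (\<xi> j \<omega>)) = distr (distr M borel (\<xi> j)) borel (R j)"
      using rv[OF that] by (simp add: distr_distr o_def)
    then show ?thesis
      using that law[of j] uniform_sphere_rotation_invariant[OF R[of j]] by simp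
  qed
  then have "PiM {1..n} (\<lambda>j. distr M borel (\<lambda>\<omega>. R j (\<xi> j \<omega>))) = PiM {1..n} (\<lambda>j. distr M borel (\<xi> j))"
    by (intro PiM_cong) auto
  then have eq: "distr M ?P (\<lambda>\<omega>. \<lambda>j\<in>{1..n}. R j (\<xi> j \<omega>)) = distr M ?P (\<lambda>\<omega>. \<lambda>j\<in>{1..n}. \<xi> j \<omega>)"
    using indep_vars_iff_distr_eq_PiM'[where M' = "\<lambda>_. borel" and X = \<xi> and I = "{1..n}"]
      indep_vars_iff_distr_eq_PiM'[where M' = "\<lambda>_. borel" and X = "\<lambda>j \<omega>. R j (\<xi> j \<omega>)" and I = "{1..n}"]
      ind indR rv rvR n by simp
  \<comment> \<open>The sum reads only the coordinates in \<open>{1..n}\<close>, so it factors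
    through the restricted family whose law has just been identified.\<close>
  define g where "g f = h (\<Sum>j=1..n. A j *v f j)" for f :: "nat \<Rightarrow> real ^ 'd"
  have g: "g \<in> borel_measurable ?P" unfolding g_def by measurable
  have gX: "(\<integral>\<omega>. g (\<lambda>j\<in>{1..n}. X j \<omega>) \<partial>M) = (\<integral>f. g f \<partial>distr M ?P (\<lambda>\<omega>. \<lambda>j\<in>{1..n}. X j \<omega>))"
    if "\<And>j. j \<in> {1..n} \<Longrightarrow> X j \<in> borel_measurable M" for X :: "nat \<Rightarrow> 'a \<Rightarrow> real ^ 'd"
    using that g by (intro integral_distr[symmetric] measurable_restrict) auto
  have "(\<integral>\<omega>. g (\<lambda>j\<in>{1..n}. R j (\<xi> j \<omega>)) \<partial>M) = (\<integral>\<omega>. g (\<lambda>j\<in>{1..n}. \<xi> j \<omega>) \<partial>M)"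
    using gX[OF rv] gX[OF rvR] by (simp only: eq)
  moreover have "g (\<lambda>j\<in>{1..n}. f j) = h (\<Sum>j=1..n. A j *v f j)" for f
    unfolding g_def by (intro arg_cong[where f = h] sum.cong) auto
  ultimately show ?thesis by simp
qed

text \<open>Averaging over all flips leaves the expectation of \<open>h (X \<omega>)\<close>
  unchanged. With \<open>h\<close> the squared norm this identifies the threshold as
  \<open>sqrt s\<close>; with \<open>h\<close> the indicator of exceeding it, the claim reduces to
  \<open>sign_chaos_nonpos\<close> at almost every fixed \<omega>.\<close>

lemma tail_probability_bound:
  fixes M :: "'a measure" and \<xi> :: "nat \<Rightarrow> 'a \<Rightarrow> real ^ 'd::finite" and A :: "nat \<Rightarrow> real ^ 'd ^ 'd"
  assumes M: "prob_space M"
    and indep: "prob_space.indep_vars M (\<lambda>_. borel) \<xi> {1..}"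
    and law: "\<And>j. j \<ge> 1 \<Longrightarrow> distr M borel (\<xi> j) = uniform_sphere"
    and n: "n \<ge> 1"
  shows "measure M {\<omega> \<in> space M. norm (\<Sum>j=1..n. A j *v \<xi> j \<omega>)
    > sqrt (\<integral>\<omega>. (norm (\<Sum>j=1..n. A j *v \<xi> j \<omega>))\<^sup>2 \<partial>M)} \<le> 113 / 114"
proof -
  interpret prob_space M by fact
  have "\<exists>e m. orthonormal_family e \<and> (\<forall>a. (norm (A j *v e a))\<^sup>2 = m)" for j
    by (rule equal_norm_orthonormal_family[of "A j"]) blast
  then obtain e m where e: "\<And>j. orthonormal_family (e j)"
    and m: "\<And>j a. (norm (A j *v e j a))\<^sup>2 = m j" by metis
  \<comment> \<open>One sign for each pair of a summand and a vector of its basis.\<close>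
  define K where "K = {1..n} \<times> (UNIV :: 'd set)"
  define s where "s = (\<Sum>j=1..n. m j)"
  define X where "X \<omega> = (\<Sum>j=1..n. A j *v \<xi> j \<omega>)" for \<omega>
  define R where "R B j = flip (e j) (\<lambda>a. sgn_of B (j, a))" for B j
  define Y where "Y B \<omega> = (\<Sum>j=1..n. A j *v R B j (\<xi> j \<omega>))" for B \<omega>
  define v where "v \<omega> = (\<lambda>(j, a). (\<xi> j \<omega> \<bullet> e j a) *\<^sub>R (A j *v e j a))" for \<omega>
  have fin: "finite K" by (simp add: K_def)
  \<comment> \<open>Any basis index shows that \<open>m j\<close> is a squared norm;
    \<open>undefined\<close> merely picks one.\<close>
  have s0: "0 \<le> s" unfolding s_def m[of _ undefined, symmetric] by (simp add: sum_nonneg)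
  have orthR: "orthogonal_transformation (R B j)" for B j
    unfolding R_def by (rule orthogonal_transformation_flip[OF e]) simp
  have rv: "\<xi> j \<in> borel_measurable M" if "j \<in> {1..n}" for j
    using indep that by (auto simp: indep_vars_def)
  have [measurable]: "R B j \<in> borel_measurable borel" for B j
    using orthR[of B j] by (intro borel_measurable_continuous_onI linear_continuous_on)
      (simp add: orthogonal_transformation_def linear_conv_bounded_linear)
  have [measurable]: "(*v) B \<in> borel_measurable borel" for B :: "real ^ 'd ^ 'd"
    by (intro borel_measurable_continuous_onI linear_continuous_on) (simp add: matrix_vector_mul_bounded_linear)
  have Xm [measurable]: "X \<in> borel_measurable M" and Ym [measurable]: "Y B \<in> borel_measurable M" for B
    unfolding X_def[abs_def] Y_def[abs_def] using rv by (auto intro!: borel_measurable_sum)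
  have lawY: "(\<integral>\<omega>. h (Y B \<omega>) \<partial>M) = (\<integral>\<omega>. h (X \<omega>) \<partial>M)"
    if "h \<in> borel_measurable borel" for h :: "real ^ 'd \<Rightarrow> real" and B
    unfolding X_def Y_def by (rule integral_rotated_sum[OF M indep law orthR n that])
  have avg: "(\<integral>\<omega>. sign_avg K (\<lambda>B. h (Y B \<omega>)) \<partial>M) = (\<integral>\<omega>. h (X \<omega>) \<partial>M)"
    if "h \<in> borel_measurable borel" "\<And>B. B \<subseteq> K \<Longrightarrow> integrable M (\<lambda>\<omega>. h (Y B \<omega>))" for h :: "real ^ 'd \<Rightarrow> real"
  proof -
    have "(\<integral>\<omega>. sign_avg K (\<lambda>B. h (Y B \<omega>)) \<partial>M) = sign_avg K (\<lambda>B. \<integral>\<omega>. h (Y B \<omega>) \<partial>M)"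
      unfolding sign_avg_def using that(2) by simp
    then show ?thesis by (simp add: lawY[OF that(1)] sign_avg_const[OF fin])
  qed
  have Y: "Y B \<omega> = sign_sum K (v \<omega>) B" for B \<omega>
  proof -
    have "A j *v R B j x = (\<Sum>a\<in>UNIV. sgn_of B (j, a) *\<^sub>R (x \<bullet> e j a) *\<^sub>R (A j *v e j a))" for j x
      by (simp add: R_def flip_def linear_sum[OF matrix_vector_mul_linear] matrix_vector_mult_scaleR)
    then show ?thesis
      by (simp add: Y_def sign_sum_def K_def v_def sum.cartesian_product split_def)
  qed
  have "AE \<omega> in M. \<forall>j\<in>{1..n}. norm (\<xi> j \<omega>) = 1"
  proof (rule AE_finite_allI)
    fix j assume j: "j \<in> {1..n}"
    then have "distr M borel (\<xi> j) = uniform_sphere"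
      using law[of j] by simp
    then have "AE x in distr M borel (\<xi> j). norm x = 1"
      by (simp only: AE_uniform_sphere)
    then show "AE \<omega> in M. norm (\<xi> j \<omega>) = 1"
      using rv[OF j] by (simp add: AE_distr_iff)
  qed simp
  \<comment> \<open>Here the equal norms matter: by Parseval the squared coordinates of \<xi> j, all
    weighted by the same \<open>m j\<close>, add up to \<open>m j\<close>. The diagonal is thus a
    constant, although \<open>v\<close> is random.\<close>
  then have ae: "AE \<omega> in M. (\<Sum>k\<in>K. (norm (v \<omega> k))\<^sup>2) = s"
  proof (rule AE_mp, intro AE_I2 impI)
    fix \<omega> assume 1: "\<forall>j\<in>{1..n}. norm (\<xi> j \<omega>) = 1"
    have "(\<Sum>k\<in>K. (norm (v \<omega> k))\<^sup>2) = (\<Sum>j=1..n. \<Sum>a\<in>UNIV. (\<xi> j \<omega> \<bullet> e j a)\<^sup>2 * m j)"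
      by (simp add: K_def v_def sum.cartesian_product split_def power_mult_distrib m)
    also have "\<dots> = (\<Sum>j=1..n. (\<xi> j \<omega> \<bullet> \<xi> j \<omega>) * m j)"
    proof (intro sum.cong refl)
      fix j
      show "(\<Sum>a\<in>UNIV. (\<xi> j \<omega> \<bullet> e j a)\<^sup>2 * m j) = (\<xi> j \<omega> \<bullet> \<xi> j \<omega>) * m j"
        unfolding orthonormal_family_Parseval[OF e[of j], of "\<xi> j \<omega>" "\<xi> j \<omega>"]
        by (simp add: sum_distrib_right power2_eq_square)
    qed
    also have "\<dots> = s"
      unfolding s_def using 1 by (intro sum.cong) (auto simp: power2_norm_eq_inner[symmetric])
    finally show "(\<Sum>k\<in>K. (norm (v \<omega> k))\<^sup>2) = s" .
  qed
  have ae2: "AE \<omega> in M. sign_avg K (\<lambda>B. (norm (Y B \<omega>))\<^sup>2) = s"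
    using ae
  proof (rule AE_mp, intro AE_I2 impI)
    fix \<omega> assume "(\<Sum>k\<in>K. (norm (v \<omega> k))\<^sup>2) = s"
    then have "(norm (Y B \<omega>))\<^sup>2 = sign_chaos K (v \<omega>) B + s" for B
      by (simp add: sign_chaos_def Y)
    then show "sign_avg K (\<lambda>B. (norm (Y B \<omega>))\<^sup>2) = s"
      using sign_chaos_mean[OF fin, of "v \<omega>"] by (simp add: sign_avg_add sign_avg_const[OF fin])
  qed
  have "(\<integral>\<omega>. (norm (X \<omega>))\<^sup>2 \<partial>M) = (\<integral>\<omega>. sign_avg K (\<lambda>B. (norm (Y B \<omega>))\<^sup>2) \<partial>M)"
  proof (rule avg[symmetric])
    fix B assume B: "B \<subseteq> K"
    \<comment> \<open>Integrability comes for free: a single nonnegative term is at most the whole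
      sum over \<open>Pow K\<close>, which is almost surely \<open>s * 2 ^ card K\<close>.\<close>
    have "AE \<omega> in M. norm ((norm (Y B \<omega>))\<^sup>2) \<le> s * 2 ^ card K"
      using ae2
    proof (rule AE_mp, intro AE_I2 impI)
      fix \<omega> assume *: "sign_avg K (\<lambda>B. (norm (Y B \<omega>))\<^sup>2) = s"
      have "(norm (Y B \<omega>))\<^sup>2 \<le> (\<Sum>B\<in>Pow K. (norm (Y B \<omega>))\<^sup>2)"
        using B fin by (intro member_le_sum) auto
      also have "\<dots> = s * 2 ^ card K"
        using * by (simp add: sign_avg_def field_simps)
      finally show "norm ((norm (Y B \<omega>))\<^sup>2) \<le> s * 2 ^ card K" by simp
    qed
    then show "integrable M (\<lambda>\<omega>. (norm (Y B \<omega>))\<^sup>2)"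
      by (rule integrable_const_bound) measurable
  qed measurable
  also have "\<dots> = (\<integral>\<omega>. s \<partial>M)"
    using ae2 by (intro integral_cong_AE) (auto simp: sign_avg_def)
  finally have second: "(\<integral>\<omega>. (norm (X \<omega>))\<^sup>2 \<partial>M) = s" by (simp add: prob_space)
  define h where "h x = (of_bool (sqrt s < norm x) :: real)" for x :: "real ^ 'd"
  have h [measurable]: "h \<in> borel_measurable borel" unfolding h_def of_bool_def by measurable
  have ae3: "AE \<omega> in M. sign_avg K (\<lambda>B. h (Y B \<omega>)) \<le> 113 / 114"
    using ae
  proof (rule AE_mp, intro AE_I2 impI)
    fix \<omega> assume *: "(\<Sum>k\<in>K. (norm (v \<omega> k))\<^sup>2) = s"
    \<comment> \<open>The exceedance is strict, so its complement is exactly the event of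
      nonpositive chaos, ties included.\<close>
    have "sqrt s < norm (Y B \<omega>) \<longleftrightarrow> \<not> sign_chaos K (v \<omega>) B \<le> 0" for B
      using s0 real_sqrt_less_iff[of s "(norm (Y B \<omega>))\<^sup>2"] by (simp add: sign_chaos_def Y * not_le)
    then have "h (Y B \<omega>) = 1 + (- 1) * of_bool (sign_chaos K (v \<omega>) B \<le> 0)" for B
      by (simp add: h_def)
    then have "sign_avg K (\<lambda>B. h (Y B \<omega>)) = 1 + (- 1) * sign_avg K (\<lambda>B. of_bool (sign_chaos K (v \<omega>) B \<le> 0))"
      by (simp only: sign_avg_add sign_avg_cmult sign_avg_const[OF fin])
    then show "sign_avg K (\<lambda>B. h (Y B \<omega>)) \<le> 113 / 114"
      using sign_chaos_nonpos[OF fin, of "v \<omega>"] by simp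
  qed
  have hint: "integrable M (\<lambda>\<omega>. h (Y B \<omega>))" for B
    by (rule integrable_const_bound[where B = 1]) (auto simp: h_def)
  have "measure M {\<omega> \<in> space M. sqrt s < norm (X \<omega>)} = (\<integral>\<omega>. indicator {\<omega> \<in> space M. sqrt s < norm (X \<omega>)} \<omega> \<partial>M)"
    by simp
  also have "\<dots> = (\<integral>\<omega>. h (X \<omega>) \<partial>M)"
    by (intro Bochner_Integration.integral_cong) (auto simp: h_def)
  also have "\<dots> = (\<integral>\<omega>. sign_avg K (\<lambda>B. h (Y B \<omega>)) \<partial>M)"
    by (rule avg[OF h hint, symmetric])
  also have "\<dots> \<le> (\<integral>\<omega>. 113 / 114 \<partial>M)"
    using ae3 hint by (intro integral_mono_AE) (auto simp: sign_avg_def)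
  finally have "measure M {\<omega> \<in> space M. sqrt s < norm (X \<omega>)} \<le> 113 / 114" by (simp add: prob_space)
  then show ?thesis using second unfolding X_def by simp
qed

theorem corollary3:
  fixes M :: "'a measure" and \<xi> :: "nat \<Rightarrow> 'a \<Rightarrow> real ^ 'd::finite"
  assumes "prob_space M"
    and "prob_space.indep_vars M (\<lambda>_. borel) \<xi> {1..}"
    and "\<And>j. j \<ge> 1 \<Longrightarrow> distr M borel (\<xi> j) = uniform_sphere"
  shows "tail_sup M \<xi> \<le> 1 - (7 - 4 * sqrt 3) / 75"
proof -
  have "tail_sup M \<xi> \<le> 113 / 114"
    unfolding tail_sup_def
    by (rule cSup_least) (use tail_probability_bound[OF assms] in auto)
  \<comment> \<open>This crude bound suffices: it gives \<open>7 - 4 * sqrt 3 <= 0.2 <= 1/2\<close>,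
    and \<open>1/150 < 1/114\<close>.\<close>
  moreover have "1.7 \<le> sqrt 3"
    by (rule real_le_rsqrt) (simp add: power2_eq_square)
  then have "(7 - 4 * sqrt 3) / 75 \<le> (1 / 2) / 75"
    by (intro divide_right_mono) simp_all
  then have "1 - (1 / 2) / 75 \<le> 1 - (7 - 4 * sqrt 3) / 75"
    by (rule diff_left_mono)
  moreover have "113 / 114 \<le> 1 - (1 / 2) / (75 :: real)"
    by simp
  ultimately show ?thesis by (meson order_trans)
qed

end
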